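(* Let $(R,v)$ be a discrete valuation domain with a uniformizing parameter $\pi$. Let $f=\sum_{i=0}^\infty a_i z^i\in R[[z]]$ be such that $a_0=u\pi^k$ for some unit $u\in R$ and a positive integer $k$. Suppose there exists a positive integer $n$ for which the following conditions are satisfied: (i) $v(a_n)=0$ and $\gcd(k,n)=1$; (ii) $\frac{k}{n}<\frac{v(a_i)}{n-i}$ for each $i=1,\ldots,n-1$. Then $f$ is irreducible in $R[[z]]$.
   Context: $R[[z]]$ denotes the ring of formal power series in $z$ over $R$. The valuation $v$ is normalized so that $v(\pi)=1$, with $v(0)=\infty$. *)

theory Defs
  imports
    "HOL-Library.Extended_Real"
    "HOL-Computational_Algebra.Formal_Power_Series"
    "HOL-Computational_Algebra.Polynomial_Factorial"
begin

text \<open>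
  A normalized discrete valuation of a field: the value group is exactly the additive
  group of integers, and the value infinity is taken at zero only.
\<close>

definition discrete_valuation :: "('k::field \<Rightarrow> ereal) \<Rightarrow> bool" where
  "discrete_valuation v \<longleftrightarrow>
     (\<forall>x. v x = \<infinity> \<longleftrightarrow> x = 0) \<and>
     (\<forall>x y. v (x * y) = v x + v y) \<and>
     (\<forall>x y. min (v x) (v y) \<le> v (x + y)) \<and>
     v ` (- {0}) = range (\<lambda>m::int. ereal (of_int m))"

text \<open>
  The domain \<open>'a\<close> is the valuation ring of a discrete valuation \<open>v\<close> on its field of fractions.
\<close>

definition discrete_valuation_domain :: "('a::idom fract \<Rightarrow> ereal) \<Rightarrow> bool" where
  "discrete_valuation_domain v \<longleftrightarrow>
     discrete_valuation v \<and> range (to_fract :: 'a \<Rightarrow> 'a fract) = {x. 0 \<le> v x}"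

definition uniformizing_parameter :: "('a::idom fract \<Rightarrow> ereal) \<Rightarrow> 'a \<Rightarrow> bool" where
  "uniformizing_parameter v p \<longleftrightarrow> v (to_fract p) = 1"

end

theory Submission
  imports Defs
begin

text \<open>
  The proof is a Newton polygon argument.  Give the term \<open>a z\<^sup>i\<close> the weight \<open>n v(a) + k i\<close>; the
  lines of constant weight have slope \<open>- k / n\<close> in the plane of the points \<open>(i, v(a\<^sub>i))\<close>.  The
  hypotheses say exactly that the least weight of a term of \<open>f\<close> is \<open>n k\<close> and that it is attained
  at the indices \<open>0\<close> and \<open>n\<close> only: the Newton polygon of \<open>f\<close> is one segment, and since \<open>k\<close> and
  \<open>n\<close> are coprime there is no lattice point in its interior.

  Suppose \<open>f = g h\<close>, and let \<open>i\<close> and \<open>j\<close> be the last indices at which \<open>g\<close> and \<open>h\<close> attain their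
  least weights.  As in the Gauss lemma, least weights add and last minimising indices add, so
  \<open>i + j = n\<close>.  As \<open>f\<close> has least weight at the index \<open>0\<close>, so have \<open>g\<close> and \<open>h\<close>.  Comparing the
  weights of \<open>g\<close> at \<open>0\<close> and \<open>i\<close> shows that \<open>n\<close> divides \<open>k i\<close>, hence \<open>i\<close>, so one factor has its
  last minimum at \<open>n\<close>.  The constant term of that factor has valuation at least \<open>k\<close>, which is the
  whole valuation of \<open>f\<^sub>0\<close>; the constant term of the other factor is therefore a unit of \<open>R\<close>, and
  that factor is a unit of \<open>R[[z]]\<close>.
\<close>

section \<open>Valuations with values in the extended natural numbers\<close>

text \<open>
  On the valuation ring itself all values are natural numbers or \<open>\<infinity>\<close>.  Taking them in \<^typ>\<open>enat\<close>,
  which is well-ordered, provides the least weights that the argument compares.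
\<close>

locale enat_valuation =
  fixes w :: "'a::idom \<Rightarrow> enat"
  assumes val_mult: "w (x * y) = w x + w y"
    and val_add: "min (w x) (w y) \<le> w (x + y)"
    and val_eq_infinity_iff: "w x = \<infinity> \<longleftrightarrow> x = 0"
begin

lemma val_zero [simp]: "w 0 = \<infinity>"
  by (simp add: val_eq_infinity_iff)

lemma val_one [simp]: "w 1 = 0"
proof -
  have "w 1 = w 1 + w 1" using val_mult[of 1 1] by simp
  moreover have "w 1 \<noteq> \<infinity>" by (simp add: val_eq_infinity_iff)
  ultimately show ?thesis by (cases "w 1") (auto simp: zero_enat_def)
qed

lemma val_unit: "x dvd 1 \<Longrightarrow> w x = 0"
  by (metis dvdE val_mult val_one add_is_0 iadd_is_0)

lemma val_minus [simp]: "w (- x) = w x"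
proof -
  have "(- 1 :: 'a) dvd 1" by simp
  then have "w (- 1) = 0" by (rule val_unit)
  then show ?thesis using val_mult[of "- 1" x] by simp
qed

lemma val_power: "w (x ^ m) = of_nat m * w x"
  by (induction m) (simp_all add: val_mult algebra_simps)

text \<open>
  The ultrametric inequality, composed with an increasing affine map so that it applies to weights.
\<close>

lemma less_affine_val_add:
  fixes a b c :: enat
  assumes "c < a * w x + b" "c < a * w y + b"
  shows "c < a * w (x + y) + b"
proof -
  have "a * min (w x) (w y) + b \<le> a * w (x + y) + b"
    by (intro add_right_mono mult_left_mono val_add) auto
  moreover have "c < a * min (w x) (w y) + b"
    using assms by (simp add: min_def)
  ultimately show ?thesis by (rule less_le_trans[rotated])
qed

lemma less_affine_val_sum:
  fixes a b c :: enat
  assumes "finite A" "a \<noteq> 0" "c \<noteq> \<infinity>" "\<And>x. x \<in> A \<Longrightarrow> c < a * w (F x) + b"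
  shows "c < a * w (sum F A) + b"
  using assms(1,4)
proof (induction A rule: finite_induct)
  case empty
  then show ?case using assms(2,3) by (cases c; cases a) (auto simp: zero_enat_def)
next
  case (insert x A)
  then show ?case by (simp add: less_affine_val_add)
qed

section \<open>Weights of the terms of a power series\<close>

definition weight :: "nat \<Rightarrow> nat \<Rightarrow> 'a fps \<Rightarrow> nat \<Rightarrow> enat" where
  "weight n k g i = enat n * w (fps_nth g i) + enat (k * i)"

text \<open>
  The index is the last one at which the least weight is attained: it is the right end of the edge
  of slope \<open>- k / n\<close> (possibly a single vertex) of the Newton polygon.
\<close>

definition last_min_weight :: "nat \<Rightarrow> nat \<Rightarrow> 'a fps \<Rightarrow> nat \<Rightarrow> bool" where
  "last_min_weight n k g i \<longleftrightarrow> weight n k g i \<noteq> \<infinity> \<and>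
     (\<forall>j. weight n k g i \<le> weight n k g j) \<and> (\<forall>j>i. weight n k g i < weight n k g j)"

text \<open>
  The least weight is attained only finitely often, because weights grow at least like \<open>k i\<close>.
\<close>

lemma last_min_weight_exists:
  assumes "g \<noteq> 0" "k > 0"
  obtains i where "last_min_weight n k g i"
proof -
  let ?W = "weight n k g"
  have "(LEAST e. e \<in> range ?W) \<in> range ?W" by (rule LeastI[of _ "?W 0"]) simp
  then obtain i0 where "(LEAST e. e \<in> range ?W) = ?W i0" by blast
  then have le: "?W i0 \<le> ?W j" for j
    by (metis Least_le rangeI)
  obtain l where "fps_nth g l \<noteq> 0" using assms(1) by (auto simp: fps_eq_iff)
  then obtain c where "w (fps_nth g l) = enat c"
    using val_eq_infinity_iff by (cases "w (fps_nth g l)") auto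
  then have "?W l \<noteq> \<infinity>" by (simp add: weight_def)
  with le[of l] obtain m where m: "?W i0 = enat m"
    by (cases "?W i0") auto
  define M where "M = {j. ?W j = enat m}"
  have "j \<le> m" if "j \<in> M" for j
  proof -
    have "enat (k * j) \<le> ?W j" by (simp add: weight_def)
    then have "k * j \<le> m" using that by (simp add: M_def)
    then show ?thesis using assms(2) by (cases k) auto
  qed
  then have fin: "finite M" by (meson finite_nat_set_iff_bounded_le)
  have "M \<noteq> {}" using m by (auto simp: M_def)
  then have max: "Max M \<in> M" using fin by simp
  have "last_min_weight n k g (Max M)"
    unfolding last_min_weight_def
  proof (intro conjI allI impI)
    show "?W (Max M) \<noteq> \<infinity>" using max by (simp add: M_def)
    show "?W (Max M) \<le> ?W j" for j using max le[of j] m by (simp add: M_def)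
    show "?W (Max M) < ?W j" if "Max M < j" for j
    proof -
      have "j \<notin> M" using that fin Max_ge not_le by blast
      then show ?thesis using max le[of j] m by (auto simp: M_def)
    qed
  qed
  then show ?thesis by (rule that)
qed

lemma weight_add_weight:
  "weight n k g i + weight n k h j
     = enat n * w (fps_nth g i * fps_nth h j) + enat (k * (i + j))"
  by (simp add: weight_def val_mult algebra_simps flip: plus_enat_simps(1))

lemma last_min_weights_less:
  assumes "last_min_weight n k g i" "last_min_weight n k h j" "i < x \<or> j < y"
  shows "weight n k g i + weight n k h j < weight n k g x + weight n k h y"
proof -
  obtain a b where ab: "weight n k g i = enat a" "weight n k h j = enat b"
    using assms by (auto simp: last_min_weight_def)
  have "enat a \<le> weight n k g x" "enat b \<le> weight n k h y"
    "enat a < weight n k g x \<or> enat b < weight n k h y"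
    using assms by (auto simp: last_min_weight_def simp flip: ab)
  then show ?thesis
    unfolding ab by (cases "weight n k g x"; cases "weight n k h y") auto
qed

text \<open>
  Past the sum of the two last minimising indices, each product of terms contains one factor that
  lies past its own minimum.
\<close>

lemma weight_mult_past_last_min:
  assumes g: "last_min_weight n k g i" and h: "last_min_weight n k h j"
    and "n > 0" "i + j < l"
  shows "weight n k g i + weight n k h j < weight n k (g * h) l"
  unfolding weight_def[of n k "g * h"] fps_mult_nth
proof (rule less_affine_val_sum)
  show "weight n k g i + weight n k h j \<noteq> \<infinity>"
    using g h by (simp add: last_min_weight_def plus_eq_infty_iff_enat)
  fix x assume x: "x \<in> {0..l}"
  have "i < x \<or> j < l - x" using \<open>i + j < l\<close> by linarith
  then have "weight n k g i + weight n k h j < weight n k g x + weight n k h (l - x)"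
    by (rule last_min_weights_less[OF g h])
  then show "weight n k g i + weight n k h j
      < enat n * w (fps_nth g x * fps_nth h (l - x)) + enat (k * l)"
    using x by (simp add: weight_add_weight)
qed (use \<open>n > 0\<close> in \<open>auto simp: zero_enat_def\<close>)

text \<open>
  At the sum of the two indices exactly one product of terms has the minimal weight, so the other
  products cannot cancel it.
\<close>

lemma weight_mult_at_last_min:
  assumes g: "last_min_weight n k g i" and h: "last_min_weight n k h j" and "n > 0"
  shows "weight n k (g * h) (i + j) \<le> weight n k g i + weight n k h j"
proof (rule ccontr)
  let ?c = "weight n k g i + weight n k h j"
  let ?F = "\<lambda>x. fps_nth g x * fps_nth h (i + j - x)"
  let ?A = "{0..i + j} - {i}"
  assume "\<not> ?thesis"
  then have whole: "?c < enat n * w (fps_nth (g * h) (i + j)) + enat (k * (i + j))"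
    by (simp add: weight_def[of n k "g * h"])
  have rest: "?c < enat n * w (sum ?F ?A) + enat (k * (i + j))"
  proof (rule less_affine_val_sum)
    show "?c \<noteq> \<infinity>"
      using g h by (simp add: last_min_weight_def plus_eq_infty_iff_enat)
    fix x assume x: "x \<in> ?A"
    then have "i < x \<or> j < i + j - x" by auto
    then have "?c < weight n k g x + weight n k h (i + j - x)"
      by (rule last_min_weights_less[OF g h])
    then show "?c < enat n * w (?F x) + enat (k * (i + j))"
      using x by (simp add: weight_add_weight)
  qed (use \<open>n > 0\<close> in \<open>auto simp: zero_enat_def\<close>)
  have "fps_nth (g * h) (i + j) = ?F i + sum ?F ?A"
    unfolding fps_mult_nth by (rule sum.remove) auto
  \<comment> \<open>The isolated product is a difference of two elements of larger weight.\<close>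
  then have "?F i = fps_nth (g * h) (i + j) + (- sum ?F ?A)" by simp
  then have "?c < enat n * w (?F i) + enat (k * (i + j))"
    using less_affine_val_add[OF whole, of "- sum ?F ?A"] rest by simp
  then show False by (simp add: weight_add_weight)
qed

section \<open>Factors of a series whose Newton polygon is one primitive segment\<close>

text \<open>
  Equal weights at \<open>0\<close> and \<open>n\<close> make \<open>g\<close> drop by \<open>k\<close> in valuation between these indices, so its
  constant term already accounts for the whole valuation \<open>k\<close>.
\<close>

lemma val_cofactor_eq_0:
  assumes "n > 0" "weight n k g 0 = weight n k g n"
    and "w (fps_nth g 0) + w (fps_nth h 0) = enat k"
  shows "w (fps_nth h 0) = 0"
proof -
  obtain b c where bc: "w (fps_nth g 0) = enat b" "w (fps_nth h 0) = enat c" "b + c = k"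
    using assms(3) by (cases "w (fps_nth g 0)"; cases "w (fps_nth h 0)") auto
  have "enat (k * n) \<le> weight n k g n" by (simp add: weight_def)
  also have "\<dots> = enat (n * b)" using assms(2) bc by (simp add: weight_def)
  finally have "k \<le> b" using \<open>n > 0\<close> by (simp add: mult.commute)
  then show ?thesis using bc by (simp add: zero_enat_def)
qed

text \<open>
  The edges of slope \<open>- k / n\<close> of the two factors join up to the single edge of \<open>g h\<close>.  Each of
  them starts at the index \<open>0\<close> and ends in a lattice point; coprimality leaves only the lengths
  \<open>0\<close> and \<open>n\<close>.
\<close>

lemma val_nth_0_eq_0_of_mult:
  assumes "n > 0" "k > 0" "coprime k n"
    and const: "w (fps_nth (g * h) 0) = enat k"
    and at_n: "w (fps_nth (g * h) n) = 0"
    and above: "\<And>i. i \<noteq> 0 \<Longrightarrow> i \<noteq> n \<Longrightarrow> enat (n * k) < weight n k (g * h) i"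
  shows "w (fps_nth g 0) = 0 \<or> w (fps_nth h 0) = 0"
proof -
  have sum_k: "w (fps_nth g 0) + w (fps_nth h 0) = enat k"
    using const by (simp add: val_mult)
  then have "fps_nth g 0 \<noteq> 0" "fps_nth h 0 \<noteq> 0" by auto
  then have "g \<noteq> 0" "h \<noteq> 0" by auto
  then obtain i j where i: "last_min_weight n k g i" and j: "last_min_weight n k h j"
    using last_min_weight_exists \<open>k > 0\<close> by metis
  let ?c = "weight n k g i + weight n k h j"
  have ends: "weight n k (g * h) 0 = enat (n * k)" "weight n k (g * h) n = enat (n * k)"
    using const at_n by (simp_all add: weight_def mult.commute)
  have min0: "weight n k g i \<le> weight n k g 0" "weight n k h j \<le> weight n k h 0"
    using i j by (auto simp: last_min_weight_def)
  have weights0: "weight n k g 0 + weight n k h 0 = enat (n * k)"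
    using ends(1) weight_add_weight[of n k g 0 h 0] by (simp add: weight_def)
  have c_le: "?c \<le> enat (n * k)"
    using add_mono[OF min0] weights0 by simp
  then have le: "weight n k (g * h) (i + j) \<le> enat (n * k)"
    using weight_mult_at_last_min[OF i j \<open>n > 0\<close>] by (rule order_trans[rotated])
  have i_j: "i + j = 0 \<or> i + j = n"
    using above[of "i + j"] le by (meson not_le)
  then have "weight n k (g * h) (i + j) = enat (n * k)" using ends by auto
  then have c_eq: "?c = enat (n * k)"
    using c_le weight_mult_at_last_min[OF i j \<open>n > 0\<close>] by simp
  \<comment> \<open>Otherwise the weight of the product at \<open>n\<close> would exceed the least weight.\<close>
  have "\<not> i + j < n"
    using weight_mult_past_last_min[OF i j \<open>n > 0\<close>, of n] c_eq ends(2) by auto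
  with i_j have n_eq: "i + j = n" by auto
  \<comment> \<open>The weights of the factors at \<open>0\<close> add up to the sum of their minima, so both are minimal.\<close>
  have eq0: "weight n k g 0 = weight n k g i" "weight n k h 0 = weight n k h j"
    using min0 weights0 c_eq
    by (cases "weight n k g 0"; cases "weight n k h 0"; cases "weight n k g i";
        cases "weight n k h j"; simp)+
  have "n dvd i"
  proof -
    obtain a where a: "w (fps_nth g 0) = enat a"
      using sum_k by (cases "w (fps_nth g 0)") auto
    obtain b where b: "w (fps_nth g i) = enat b"
      using i \<open>n > 0\<close> by (cases "w (fps_nth g i)")
        (auto simp: last_min_weight_def weight_def enat_0_iff imult_is_infinity)
    have "n * a = n * b + k * i" using eq0(1) a b by (simp add: weight_def)
    then have "n dvd k * i" by (metis dvd_add_right_iff dvd_triv_left)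
    then show ?thesis using \<open>coprime k n\<close>
      by (simp add: coprime_commute coprime_dvd_mult_right_iff)
  qed
  moreover have "i \<le> n" using n_eq by simp
  ultimately have "i = 0 \<or> i = n" using dvd_imp_le by fastforce
  then show ?thesis
  proof
    assume "i = n"
    then show ?thesis using val_cofactor_eq_0[OF \<open>n > 0\<close> _ sum_k] eq0(1) by simp
  next
    assume "i = 0"
    then have "j = n" using n_eq by simp
    then show ?thesis
      using val_cofactor_eq_0[OF \<open>n > 0\<close>, of k h g] eq0(2) sum_k by (simp add: add.commute)
  qed
qed

end

lemma fps_unit_of_nth_0_unit:
  fixes g :: "'a::comm_ring_1 fps"
  assumes "fps_nth g 0 dvd 1"
  shows "g dvd 1"
proof -
  obtain y where "1 = fps_nth g 0 * y" using assms by (rule dvdE)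
  then have "g * fps_right_inverse g y = 1" by (intro fps_right_inverse) simp
  then show ?thesis by (metis dvd_triv_left)
qed

section \<open>Discrete valuation domains\<close>

lemma discrete_valuation_one:
  assumes "discrete_valuation v"
  shows "v 1 = 0"
proof -
  have "v (1 * 1) = v 1 + v 1" "1 \<in> - {0::'a}"
    using assms unfolding discrete_valuation_def by (blast, simp)
  moreover from this(2) obtain m :: int where "v 1 = ereal (of_int m)"
    using assms unfolding discrete_valuation_def by blast
  ultimately show ?thesis by simp
qed

lemma ereal_of_enat_inj: "ereal_of_enat a = ereal_of_enat b \<longleftrightarrow> a = b"
  by (cases a; cases b) auto

lemma discrete_valuation_domain_enat:
  fixes v :: "'a::idom fract \<Rightarrow> ereal"
  assumes "discrete_valuation_domain v"
  obtains w :: "'a \<Rightarrow> enat" where "\<And>x. v (to_fract x) = ereal_of_enat (w x)"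
proof -
  have "\<exists>e. v (to_fract x) = ereal_of_enat e" for x
  proof (cases "to_fract x = 0")
    case True
    then have "v (to_fract x) = ereal_of_enat \<infinity>"
      using assms unfolding discrete_valuation_domain_def discrete_valuation_def by simp
    then show ?thesis ..
  next
    case False
    then obtain m :: int where m: "v (to_fract x) = ereal (of_int m)"
      using assms unfolding discrete_valuation_domain_def discrete_valuation_def by blast
    moreover have "0 \<le> v (to_fract x)"
      using assms unfolding discrete_valuation_domain_def by blast
    ultimately have "v (to_fract x) = ereal_of_enat (enat (nat m))" by simp
    then show ?thesis ..
  qed
  then show ?thesis using that by metis
qed

lemma unit_of_valuation_eq_0:
  fixes v :: "'a::idom fract \<Rightarrow> ereal"
  assumes "discrete_valuation_domain v" "v (to_fract x) = 0"
  shows "x dvd 1"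
proof -
  have dv: "discrete_valuation v"
    and ring: "range (to_fract :: 'a \<Rightarrow> 'a fract) = {y. 0 \<le> v y}"
    using assms(1) by (simp_all add: discrete_valuation_domain_def)
  \<comment> \<open>The inverse in the field of fractions has value 0 too, hence lies in the valuation ring.\<close>
  let ?y = "inverse (to_fract x)"
  have "v (to_fract x) \<noteq> \<infinity>" using assms(2) by simp
  then have nz: "to_fract x \<noteq> 0" using dv unfolding discrete_valuation_def by blast
  have "v (to_fract x * ?y) = v (to_fract x) + v ?y"
    using dv unfolding discrete_valuation_def by blast
  then have "v ?y = 0"
    using nz assms(2) discrete_valuation_one[OF dv] by simp
  then have "?y \<in> range to_fract" using ring by simp
  then obtain z where "?y = to_fract z" by auto
  then have "to_fract (x * z) = to_fract 1"
    using nz by (metis right_inverse to_fract_1 to_fract_mult)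
  then have "x * z = 1" by (simp only: to_fract_eq_iff)
  then show ?thesis by (metis dvd_triv_left)
qed

theorem theorem8:
  fixes v :: "'a::idom fract \<Rightarrow> ereal"
    and \<pi> u :: 'a
    and f :: "'a fps"
    and k n :: nat
  assumes "discrete_valuation_domain v"
    and "uniformizing_parameter v \<pi>"
    and "u dvd 1"
    and "k > 0"
    and "fps_nth f 0 = u * \<pi> ^ k"
    and "n > 0"
    and "v (to_fract (fps_nth f n)) = 0"
    and "gcd k n = 1"
    and "\<forall>i\<in>{1..n-1}.
           ereal (real k / real n) < v (to_fract (fps_nth f i)) / ereal (real (n - i))"
  shows "irreducible f"
proof -
  obtain w :: "'a \<Rightarrow> enat" where vw: "\<And>x. v (to_fract x) = ereal_of_enat (w x)"
    using discrete_valuation_domain_enat[OF assms(1)] by blast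
  have dv: "v x = \<infinity> \<longleftrightarrow> x = 0" "v (x * y) = v x + v y" "min (v x) (v y) \<le> v (x + y)" for x y
    using assms(1) unfolding discrete_valuation_domain_def discrete_valuation_def by blast+
  interpret enat_valuation w
  proof
    fix x y :: 'a
    have "ereal_of_enat (w (x * y)) = ereal_of_enat (w x + w y)"
      using dv(2)[of "to_fract x" "to_fract y"] by (simp add: vw ereal_of_enat_add flip: to_fract_mult)
    then show "w (x * y) = w x + w y" by (simp only: ereal_of_enat_inj)
    show "min (w x) (w y) \<le> w (x + y)"
      using dv(3)[of "to_fract x" "to_fract y"]
      by (simp add: vw min_def split: if_splits flip: to_fract_add)
    show "w x = \<infinity> \<longleftrightarrow> x = 0"
      using dv(1)[of "to_fract x"] by (simp add: vw)
  qed
  have unit: "x dvd 1" if "w x = 0" for x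
    using unit_of_valuation_eq_0[OF assms(1)] that vw by simp
  have "ereal_of_enat (w \<pi>) = ereal_of_enat 1"
    using assms(2) by (simp add: uniformizing_parameter_def vw one_enat_def)
  then have "w \<pi> = 1" by (simp only: ereal_of_enat_inj)
  then have const: "w (fps_nth f 0) = enat k"
    using assms(3,5) by (simp add: val_mult val_unit val_power of_nat_eq_enat)
  have "ereal_of_enat (w (fps_nth f n)) = ereal_of_enat 0"
    using assms(7) by (simp add: vw)
  then have at_n: "w (fps_nth f n) = 0" by (simp only: ereal_of_enat_inj)
  have above: "enat (n * k) < weight n k f i" if "i \<noteq> 0" "i \<noteq> n" for i
  proof (cases "i < n")
    case True
    show ?thesis
    proof (cases "w (fps_nth f i)")
      case infinity
      then show ?thesis using \<open>n > 0\<close> by (simp add: weight_def imult_infinity_right)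
    next
      case (enat m)
      have "i \<in> {1..n-1}" using that True by auto
      then have "ereal (real k / real n) < v (to_fract (fps_nth f i)) / ereal (real (n - i))"
        using assms(9) by blast
      also have "\<dots> = ereal (real m / real (n - i))"
        using True by (simp add: vw enat)
      finally have "real k / real n < real m / real (n - i)" by simp
      then have "real k * real (n - i) < real m * real n"
        using True by (simp add: divide_simps mult.commute)
      then have "k * (n - i) < m * n"
        by (simp only: of_nat_less_iff flip: of_nat_mult)
      moreover have "n * k = k * (n - i) + k * i"
        using True by (simp add: algebra_simps flip: add_mult_distrib2)
      ultimately show ?thesis using enat by (simp add: weight_def mult.commute)
    qed
  next
    case False
    then have "enat (n * k) < enat (k * i)" using that \<open>k > 0\<close> by (simp add: mult.commute)
    also have "\<dots> \<le> weight n k f i" by (simp add: weight_def)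
    finally show ?thesis .
  qed
  show ?thesis
  proof (rule irreducibleI)
    show "f \<noteq> 0" using const by auto
    show "\<not> f dvd 1"
    proof
      assume "f dvd 1"
      then obtain g where "1 = f * g" by (rule dvdE)
      then have "1 = fps_nth f 0 * fps_nth g 0" by (metis fps_mult_nth_0 fps_one_nth)
      then have "w (fps_nth f 0) = 0" by (metis dvd_triv_left val_unit)
      then show False using const \<open>k > 0\<close> by (simp add: enat_0_iff)
    qed
    fix g h assume f: "f = g * h"
    have "w (fps_nth g 0) = 0 \<or> w (fps_nth h 0) = 0"
      using val_nth_0_eq_0_of_mult[of n k g h] assms(4,6,8) const at_n above
      unfolding f by (simp add: coprime_iff_gcd_eq_1)
    then show "g dvd 1 \<or> h dvd 1"
      using unit fps_unit_of_nth_0_unit by blast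
  qed
qed

end
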